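(* Let $X=\mathbb{R}^{\mathbb{R}_+}$ be the set of all functions from $[0,\infty[$ to $\mathbb{R}$. The sticking topology on $X$ is Hausdorff, it is finer than the topology of point-wise convergence on $X$, and it is coarser than the topology of locally uniform convergence on $X$.
   Context: $\mathbb{R}_+=[0,\infty[$ has its usual topology. For $f\in X$, $\varepsilon>0$ and $t_1,\dots,t_k\in\mathbb{R}_+$, the elementary neighbourhood is $$E^\varepsilon_{t_1,\ldots,t_k}(f)=\{g\in X : \exists \eta>0,\ \forall t\in\mathbb{R}_+\cap\bigcup_{i=1}^k]t_i-\eta,t_i+\eta[,\ |f(t)-g(t)|<\varepsilon\}.$$ A subset $U\subset X$ is open for the sticking topology iff for each $f\in U$ it contains some elementary neighbourhood $E^\varepsilon_{t_1,\ldots,t_k}(f)$ of $f$. "Finer" and "coarser" are meant in the non-strict sense. *)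

theory Defs
  imports "HOL-Analysis.Analysis"
begin

text \<open>The set of all functions from \<open>[0,\<infinity>[\<close> to \<open>\<real>\<close>, encoded by extensional functions (with value
  \<open>undefined\<close> outside \<open>[0,\<infinity>[\<close>), so that equality in \<open>real_funs\<close> is equality on \<open>[0,\<infinity>[\<close>.\<close>

definition real_funs :: "(real \<Rightarrow> real) set" where
  "real_funs = {0..} \<rightarrow>\<^sub>E (UNIV :: real set)"

text \<open>The points \<open>t\<^sub>1,\<dots>,t\<^sub>k\<close> enter the neighbourhood only through the set \<open>T = {t\<^sub>1,\<dots>,t\<^sub>k}\<close>, which
  ranges over the nonempty finite subsets of \<open>[0,\<infinity>[\<close>.\<close>

definition elementary_nbhd :: "real \<Rightarrow> real set \<Rightarrow> (real \<Rightarrow> real) \<Rightarrow> (real \<Rightarrow> real) set" where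
  "elementary_nbhd \<epsilon> T f =
     {g \<in> real_funs. \<exists>\<eta>>0. \<forall>t \<in> {0..} \<inter> (\<Union>s\<in>T. {s - \<eta><..<s + \<eta>}). \<bar>f t - g t\<bar> < \<epsilon>}"

text \<open>\<^term>\<open>topology P\<close> has \<open>P\<close> as its open sets only if \<open>istopology P\<close> holds; this is established by
  \<open>openin_sticking_topology\<close> and \<open>openin_locally_uniform_topology\<close>.\<close>

definition sticking_topology :: "(real \<Rightarrow> real) topology" where
  "sticking_topology = topology (\<lambda>U. U \<subseteq> real_funs \<and>
     (\<forall>f\<in>U. \<exists>\<epsilon>>0. \<exists>T. finite T \<and> T \<noteq> {} \<and> T \<subseteq> {0..} \<and> elementary_nbhd \<epsilon> T f \<subseteq> U))"

text \<open>The half-line being locally compact, locally uniform convergence is uniform convergence on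
  compact subsets, as \<open>limitin_locally_uniform_topology\<close> confirms.\<close>

definition locally_uniform_topology :: "(real \<Rightarrow> real) topology" where
  "locally_uniform_topology = topology (\<lambda>U. U \<subseteq> real_funs \<and>
     (\<forall>f\<in>U. \<exists>\<epsilon>>0. \<exists>K. compact K \<and> K \<subseteq> {0..} \<and>
        {g \<in> real_funs. \<forall>t\<in>K. \<bar>f t - g t\<bar> < \<epsilon>} \<subseteq> U))"

definition pointwise_topology :: "(real \<Rightarrow> real) topology" where
  "pointwise_topology = product_topology (\<lambda>_. euclideanreal) {0..}"

definition finer_topology :: "'a topology \<Rightarrow> 'a topology \<Rightarrow> bool" where
  "finer_topology S T \<longleftrightarrow> topspace S = topspace T \<and> (\<forall>U. openin T U \<longrightarrow> openin S U)"

abbreviation (input) coarser_topology :: "'a topology \<Rightarrow> 'a topology \<Rightarrow> bool" where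
  "coarser_topology S T \<equiv> finer_topology T S"

lemma elementary_nbhd_mono:
  assumes "\<epsilon> \<le> \<epsilon>'" "T' \<subseteq> T"
  shows "elementary_nbhd \<epsilon> T f \<subseteq> elementary_nbhd \<epsilon>' T' f"
proof
  fix g assume "g \<in> elementary_nbhd \<epsilon> T f"
  then obtain \<eta> where g: "g \<in> real_funs" "\<eta> > 0"
    and *: "\<And>t s. t \<ge> 0 \<Longrightarrow> s \<in> T \<Longrightarrow> t \<in> {s - \<eta><..<s + \<eta>} \<Longrightarrow> \<bar>f t - g t\<bar> < \<epsilon>"
    unfolding elementary_nbhd_def by blast
  have "\<forall>t \<in> {0..} \<inter> (\<Union>s\<in>T'. {s - \<eta><..<s + \<eta>}). \<bar>f t - g t\<bar> < \<epsilon>'"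
  proof
    fix t assume "t \<in> {0..} \<inter> (\<Union>s\<in>T'. {s - \<eta><..<s + \<eta>})"
    then obtain s where s: "s \<in> T'" "t \<in> {s - \<eta><..<s + \<eta>}" and "t \<ge> 0" by auto
    with *[of t s] assms(2) have "\<bar>f t - g t\<bar> < \<epsilon>" by blast
    with assms(1) show "\<bar>f t - g t\<bar> < \<epsilon>'" by linarith
  qed
  with g show "g \<in> elementary_nbhd \<epsilon>' T' f"
    unfolding elementary_nbhd_def by blast
qed

lemma openin_sticking_topology:
  "openin sticking_topology U \<longleftrightarrow> U \<subseteq> real_funs \<and>
     (\<forall>f\<in>U. \<exists>\<epsilon>>0. \<exists>T. finite T \<and> T \<noteq> {} \<and> T \<subseteq> {0..} \<and> elementary_nbhd \<epsilon> T f \<subseteq> U)"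
proof -
  define P where "P U \<longleftrightarrow> U \<subseteq> real_funs \<and>
     (\<forall>f\<in>U. \<exists>\<epsilon>>0. \<exists>T. finite T \<and> T \<noteq> {} \<and> T \<subseteq> {0..} \<and> elementary_nbhd \<epsilon> T f \<subseteq> U)" for U
  have "istopology P"
    unfolding istopology_def
  proof (intro conjI allI impI)
    fix U V assume U: "P U" and V: "P V"
    show "P (U \<inter> V)"
      unfolding P_def
    proof (intro conjI ballI)
      show "U \<inter> V \<subseteq> real_funs" using U P_def by blast
      fix f assume f: "f \<in> U \<inter> V"
      obtain e1 T1 where 1: "e1 > 0" "finite T1" "T1 \<noteq> {}" "T1 \<subseteq> {0..}" "elementary_nbhd e1 T1 f \<subseteq> U"
        using U f unfolding P_def by blast
      obtain e2 T2 where 2: "e2 > 0" "finite T2" "T2 \<noteq> {}" "T2 \<subseteq> {0..}" "elementary_nbhd e2 T2 f \<subseteq> V"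
        using V f unfolding P_def by blast
      have "elementary_nbhd (min e1 e2) (T1 \<union> T2) f \<subseteq> U \<inter> V"
        using elementary_nbhd_mono[of "min e1 e2" e1 T1 "T1 \<union> T2" f]
          elementary_nbhd_mono[of "min e1 e2" e2 T2 "T1 \<union> T2" f] 1 2 by auto
      then show "\<exists>\<epsilon>>0. \<exists>T. finite T \<and> T \<noteq> {} \<and> T \<subseteq> {0..} \<and> elementary_nbhd \<epsilon> T f \<subseteq> U \<inter> V"
        using 1 2 by (intro exI[of _ "min e1 e2"] conjI exI[of _ "T1 \<union> T2"]) auto
    qed
  next
    fix \<K> assume *: "\<forall>K\<in>\<K>. P K"
    show "P (\<Union> \<K>)"
      unfolding P_def
    proof (intro conjI ballI)
      show "\<Union> \<K> \<subseteq> real_funs" using * unfolding P_def by blast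
      fix f assume "f \<in> \<Union> \<K>"
      then obtain U where "U \<in> \<K>" "f \<in> U" by blast
      then show "\<exists>\<epsilon>>0. \<exists>T. finite T \<and> T \<noteq> {} \<and> T \<subseteq> {0..} \<and> elementary_nbhd \<epsilon> T f \<subseteq> \<Union> \<K>"
        using * unfolding P_def by (meson Union_upper subset_trans)
    qed
  qed
  then show ?thesis
    using topology_inverse'[of P] by (simp add: sticking_topology_def P_def[abs_def])
qed

lemma openin_locally_uniform_topology:
  "openin locally_uniform_topology U \<longleftrightarrow> U \<subseteq> real_funs \<and>
     (\<forall>f\<in>U. \<exists>\<epsilon>>0. \<exists>K. compact K \<and> K \<subseteq> {0..} \<and>
        {g \<in> real_funs. \<forall>t\<in>K. \<bar>f t - g t\<bar> < \<epsilon>} \<subseteq> U)"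
proof -
  define P where "P U \<longleftrightarrow> U \<subseteq> real_funs \<and>
     (\<forall>f\<in>U. \<exists>\<epsilon>>0. \<exists>K. compact K \<and> K \<subseteq> {0..} \<and>
        {g \<in> real_funs. \<forall>t\<in>K. \<bar>f t - g t\<bar> < \<epsilon>} \<subseteq> U)" for U :: "(real \<Rightarrow> real) set"
  have "istopology P"
    unfolding istopology_def
  proof (intro conjI allI impI)
    fix U V assume U: "P U" and V: "P V"
    show "P (U \<inter> V)"
      unfolding P_def
    proof (intro conjI ballI)
      show "U \<inter> V \<subseteq> real_funs" using U P_def by blast
      fix f assume f: "f \<in> U \<inter> V"
      obtain e1 K1 where 1: "e1 > 0" "compact K1" "K1 \<subseteq> {0..}"
        "{g \<in> real_funs. \<forall>t\<in>K1. \<bar>f t - g t\<bar> < e1} \<subseteq> U"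
        using U f unfolding P_def by blast
      obtain e2 K2 where 2: "e2 > 0" "compact K2" "K2 \<subseteq> {0..}"
        "{g \<in> real_funs. \<forall>t\<in>K2. \<bar>f t - g t\<bar> < e2} \<subseteq> V"
        using V f unfolding P_def by blast
      have "{g \<in> real_funs. \<forall>t\<in>K1 \<union> K2. \<bar>f t - g t\<bar> < min e1 e2} \<subseteq> U \<inter> V"
        using 1(4) 2(4) by auto
      then show "\<exists>\<epsilon>>0. \<exists>K. compact K \<and> K \<subseteq> {0..} \<and>
          {g \<in> real_funs. \<forall>t\<in>K. \<bar>f t - g t\<bar> < \<epsilon>} \<subseteq> U \<inter> V"
        using 1(1-3) 2(1-3) by (intro exI[of _ "min e1 e2"] conjI exI[of _ "K1 \<union> K2"]) auto
    qed
  next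
    fix \<K> assume *: "\<forall>K\<in>\<K>. P K"
    show "P (\<Union> \<K>)"
      unfolding P_def
    proof (intro conjI ballI)
      show "\<Union> \<K> \<subseteq> real_funs" using * unfolding P_def by blast
      fix f assume "f \<in> \<Union> \<K>"
      then obtain U where "U \<in> \<K>" "f \<in> U" by blast
      then show "\<exists>\<epsilon>>0. \<exists>K. compact K \<and> K \<subseteq> {0..} \<and>
          {g \<in> real_funs. \<forall>t\<in>K. \<bar>f t - g t\<bar> < \<epsilon>} \<subseteq> \<Union> \<K>"
        using * unfolding P_def by (meson Union_upper subset_trans)
    qed
  qed
  then show ?thesis
    using topology_inverse'[of P] by (simp add: locally_uniform_topology_def P_def[abs_def])
qed

lemma topspace_sticking_topology: "topspace sticking_topology = real_funs"
proof -
  have "openin sticking_topology real_funs"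
    unfolding openin_sticking_topology
    by (auto simp: elementary_nbhd_def intro!: exI[of _ "1::real"] exI[of _ "{0::real}"])
  then show ?thesis
    by (meson openin_sticking_topology openin_subset openin_topspace subset_antisym)
qed

lemma topspace_locally_uniform_topology: "topspace locally_uniform_topology = real_funs"
proof -
  have "openin locally_uniform_topology real_funs"
    unfolding openin_locally_uniform_topology
    by (auto intro!: exI[of _ "1::real"] exI[of _ "{}::real set"])
  then show ?thesis
    by (meson openin_locally_uniform_topology openin_subset openin_topspace subset_antisym)
qed

lemma topspace_pointwise_topology: "topspace pointwise_topology = real_funs"
  by (simp add: pointwise_topology_def real_funs_def)

lemma limitin_locally_uniform_topology:
  "limitin locally_uniform_topology h f F \<longleftrightarrow>
     f \<in> real_funs \<and> (\<forall>\<^sub>F x in F. h x \<in> real_funs) \<and>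
     (\<forall>t\<ge>0. \<exists>\<eta>>0. uniform_limit ({0..} \<inter> {t - \<eta><..<t + \<eta>}) h f F)"
  (is "?L \<longleftrightarrow> ?R")
proof
  assume L: ?L
  then have f: "f \<in> real_funs"
    by (simp add: limitin_def topspace_locally_uniform_topology)
  have ev: "\<forall>\<^sub>F x in F. h x \<in> real_funs"
    using L openin_topspace f unfolding limitin_def topspace_locally_uniform_topology[symmetric]
    by blast
  have "uniform_limit ({0..} \<inter> {t - 1<..<t + 1}) h f F" for t
  proof (rule uniform_limitI)
    fix e :: real assume e: "e > 0"
    define K where "K = {max 0 (t - 1)..t + 1}"
    define U where "U = {g \<in> real_funs. \<exists>\<delta><e. \<forall>s\<in>K. \<bar>f s - g s\<bar> \<le> \<delta>}"
    have "openin locally_uniform_topology U"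
      unfolding openin_locally_uniform_topology
    proof (intro conjI ballI)
      show "U \<subseteq> real_funs" by (auto simp: U_def)
      fix g assume "g \<in> U"
      then obtain \<delta> where \<delta>: "\<delta> < e" "\<forall>s\<in>K. \<bar>f s - g s\<bar> \<le> \<delta>" by (auto simp: U_def)
      have "{k \<in> real_funs. \<forall>t\<in>K. \<bar>g t - k t\<bar> < (e - \<delta>) / 2} \<subseteq> U"
      proof
        fix k assume "k \<in> {k \<in> real_funs. \<forall>t\<in>K. \<bar>g t - k t\<bar> < (e - \<delta>) / 2}"
        then have k: "k \<in> real_funs" "\<forall>t\<in>K. \<bar>g t - k t\<bar> < (e - \<delta>) / 2" by auto
        have "\<bar>f s - k s\<bar> \<le> (e + \<delta>) / 2" if "s \<in> K" for s
        proof -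
          have "\<bar>f s - g s\<bar> \<le> \<delta>" "\<bar>g s - k s\<bar> < (e - \<delta>) / 2"
            using \<delta> k that by auto
          then have "\<bar>f s - k s\<bar> \<le> \<delta> + (e - \<delta>) / 2" by linarith
          then show ?thesis by (simp add: field_simps)
        qed
        moreover have "(e + \<delta>) / 2 < e" using \<delta> by simp
        ultimately show "k \<in> U" using k unfolding U_def by blast
      qed
      then show "\<exists>\<epsilon>>0. \<exists>K. compact K \<and> K \<subseteq> {0..} \<and>
          {k \<in> real_funs. \<forall>t\<in>K. \<bar>g t - k t\<bar> < \<epsilon>} \<subseteq> U"
        using \<delta>(1) by (intro exI[of _ "(e - \<delta>) / 2"] conjI exI[of _ K]) (auto simp: K_def)
    qed
    moreover have "f \<in> U" using f e by (auto simp: U_def intro!: exI[of _ 0])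
    ultimately have "\<forall>\<^sub>F x in F. h x \<in> U" using L by (auto simp: limitin_def)
    then show "\<forall>\<^sub>F x in F. \<forall>s\<in>{0..} \<inter> {t - 1<..<t + 1}. dist (h x s) (f s) < e"
    proof eventually_elim
      case (elim x)
      then obtain \<delta> where \<delta>: "\<delta> < e" "\<forall>s\<in>K. \<bar>f s - h x s\<bar> \<le> \<delta>" by (auto simp: U_def)
      show ?case
      proof
        fix s assume "s \<in> {0..} \<inter> {t - 1<..<t + 1}"
        then have "s \<in> K" by (auto simp: K_def)
        then have "\<bar>f s - h x s\<bar> < e" using \<delta> by fastforce
        then show "dist (h x s) (f s) < e" by (simp add: dist_real_def abs_minus_commute)
      qed
    qed
  qed
  then show ?R using f ev zero_less_one by blast
next
  assume R: ?R
  show ?L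
    unfolding limitin_def topspace_locally_uniform_topology
  proof (intro conjI allI impI)
    show "f \<in> real_funs" using R by blast
    fix U assume "openin locally_uniform_topology U \<and> f \<in> U"
    then obtain e K where e: "e > 0" and K: "compact K" "K \<subseteq> {0..}"
      and sub: "{g \<in> real_funs. \<forall>t\<in>K. \<bar>f t - g t\<bar> < e} \<subseteq> U"
      unfolding openin_locally_uniform_topology by blast
    have "\<forall>t\<in>K. \<exists>\<eta>>0. uniform_limit ({0..} \<inter> {t - \<eta><..<t + \<eta>}) h f F"
      using R K(2) by auto
    then obtain \<eta> where \<eta>: "\<And>t. t \<in> K \<Longrightarrow> \<eta> t > 0"
      "\<And>t. t \<in> K \<Longrightarrow> uniform_limit ({0..} \<inter> {t - \<eta> t<..<t + \<eta> t}) h f F"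
      by metis
    obtain D where D: "D \<subseteq> K" "finite D" "K \<subseteq> (\<Union>t\<in>D. {t - \<eta> t<..<t + \<eta> t})"
      by (rule compactE_image[OF K(1), of K "\<lambda>t. {t - \<eta> t<..<t + \<eta> t}"])
         (use \<eta>(1) in force)+
    have "\<forall>t\<in>D. \<forall>\<^sub>F x in F. \<forall>s\<in>{0..} \<inter> {t - \<eta> t<..<t + \<eta> t}. dist (h x s) (f s) < e"
      using \<eta>(2) D(1) e by (blast dest: uniform_limitD)
    then have "\<forall>\<^sub>F x in F. \<forall>t\<in>D. \<forall>s\<in>{0..} \<inter> {t - \<eta> t<..<t + \<eta> t}. dist (h x s) (f s) < e"
      using D(2) by (simp add: eventually_ball_finite)
    moreover have "\<forall>\<^sub>F x in F. h x \<in> real_funs" using R by blast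
    ultimately show "\<forall>\<^sub>F x in F. h x \<in> U"
    proof eventually_elim
      case (elim x)
      have "\<bar>f s - h x s\<bar> < e" if s: "s \<in> K" for s
      proof -
        obtain t where "t \<in> D" "s \<in> {t - \<eta> t<..<t + \<eta> t}" using s D(3) by blast
        then have "dist (h x s) (f s) < e" using elim(1) s K(2) by blast
        then show ?thesis by (simp add: dist_real_def abs_minus_commute)
      qed
      then show ?case using elim(2) sub by blast
    qed
  qed
qed

end

theory Submission
  imports Defs
begin

text \<open>Membership in \<open>E\<^sup>\<epsilon>\<^sub>t(f)\<close> controls the value at \<open>t\<close>, which makes evaluation
  at \<open>t\<close> continuous for the sticking topology, so the universal property of the product
  gives the comparison with the pointwise topology. Since the latter is Hausdorff, so is every
  finer topology. Conversely, uniform closeness on the compact set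
  \<open>\<Union>\<^sub>i [t\<^sub>i - 1, t\<^sub>i + 1] \<inter> [0,\<infinity>[\<close> forces membership in an elementary neighbourhood
  at \<open>t\<^sub>1,\<dots>,t\<^sub>k\<close>, with \<open>\<eta> = 1\<close>.\<close>

text \<open>Disjoint \<open>T\<close>-open sets separating two points are also
  \<open>S\<close>-open, and both spaces have the same points.\<close>

lemma Hausdorff_space_finer_topology:
  assumes "finer_topology S T" "Hausdorff_space T"
  shows "Hausdorff_space S"
  using assms unfolding finer_topology_def Hausdorff_space_def by metis

lemma Hausdorff_space_pointwise_topology: "Hausdorff_space pointwise_topology"
  unfolding pointwise_topology_def by (simp add: Hausdorff_space_product_topology)

text \<open>Whatever \<eta> > 0 is, \<open>t\<close> lies in its own interval of radius
  \<eta>.\<close>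

lemma elementary_nbhd_singletonD:
  assumes "g \<in> elementary_nbhd \<epsilon> {t} f" "t \<ge> 0"
  shows "\<bar>f t - g t\<bar> < \<epsilon>"
  using assms by (auto simp: elementary_nbhd_def)

lemma continuous_map_sticking_topology_eval:
  assumes "t \<ge> 0"
  shows "continuous_map sticking_topology euclideanreal (\<lambda>f. f t)"
  unfolding continuous_map topspace_sticking_topology
proof (intro conjI allI impI)
  fix V :: "real set" assume "openin euclideanreal V"
  then have "open V" by simp
  show "openin sticking_topology {f \<in> real_funs. f t \<in> V}"
    unfolding openin_sticking_topology
  proof (intro conjI ballI)
    fix f assume "f \<in> {f \<in> real_funs. f t \<in> V}"
    then obtain \<epsilon> where "\<epsilon> > 0" and \<epsilon>: "\<And>y. \<bar>f t - y\<bar> < \<epsilon> \<Longrightarrow> y \<in> V"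
      using \<open>open V\<close> by (auto simp: open_contains_ball subset_iff dist_real_def)
    have "elementary_nbhd \<epsilon> {t} f \<subseteq> {f \<in> real_funs. f t \<in> V}"
      using elementary_nbhd_singletonD[OF _ assms] \<epsilon>
      by (auto simp: elementary_nbhd_def)
    with \<open>\<epsilon> > 0\<close> assms
    show "\<exists>\<epsilon>>0. \<exists>T. finite T \<and> T \<noteq> {} \<and> T \<subseteq> {0..} \<and>
        elementary_nbhd \<epsilon> T f \<subseteq> {f \<in> real_funs. f t \<in> V}"
      by (intro exI[of _ \<epsilon>] conjI exI[of _ "{t}"]) auto
  qed auto
qed auto

lemma finer_sticking_pointwise: "finer_topology sticking_topology pointwise_topology"
  unfolding finer_topology_def
proof (intro conjI allI impI)
  show "topspace sticking_topology = topspace pointwise_topology"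
    by (simp add: topspace_sticking_topology topspace_pointwise_topology)
  \<comment> \<open>The components of the identity are the evaluations; the extensionality that the
    product asks for is built into \<open>real_funs\<close>.\<close>
  have id: "continuous_map sticking_topology pointwise_topology (\<lambda>f. f)"
    unfolding pointwise_topology_def continuous_map_componentwise
    using continuous_map_sticking_topology_eval
    by (auto simp: topspace_sticking_topology real_funs_def PiE_def)
  fix U assume U: "openin pointwise_topology U"
  then have "U \<subseteq> topspace sticking_topology"
    using openin_subset by (fastforce simp: topspace_sticking_topology topspace_pointwise_topology)
  \<comment> \<open>The preimage of \<open>U\<close> under the identity is \<open>U\<close>
    itself.\<close>
  then have "{f \<in> topspace sticking_topology. f \<in> U} = U" by blast
  with openin_continuous_map_preimage[OF id U] show "openin sticking_topology U" by simp
qed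

lemma uniform_nbhd_subset_elementary_nbhd:
  "{g \<in> real_funs. \<forall>t \<in> (\<Union>s\<in>T. {max 0 (s - 1)..s + 1}). \<bar>f t - g t\<bar> < \<epsilon>} \<subseteq> elementary_nbhd \<epsilon> T f"
  unfolding elementary_nbhd_def by (force intro: exI[of _ "1::real"])

lemma finer_locally_uniform_sticking: "finer_topology locally_uniform_topology sticking_topology"
  unfolding finer_topology_def
proof (intro conjI allI impI)
  show "topspace locally_uniform_topology = topspace sticking_topology"
    by (simp add: topspace_sticking_topology topspace_locally_uniform_topology)
  fix U assume U: "openin sticking_topology U"
  show "openin locally_uniform_topology U"
    unfolding openin_locally_uniform_topology
  proof (intro conjI ballI)
    show "U \<subseteq> real_funs" using U by (simp add: openin_sticking_topology)
    fix f assume "f \<in> U"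
    then obtain \<epsilon> T where "\<epsilon> > 0" "finite T" and sub: "elementary_nbhd \<epsilon> T f \<subseteq> U"
      using U unfolding openin_sticking_topology by blast
    \<comment> \<open>Cutting off at 0 keeps \<open>K\<close> in the half-line; finiteness of
      \<open>T\<close> makes it compact.\<close>
    define K where "K = (\<Union>s\<in>T. {max 0 (s - 1)..s + 1})"
    have "compact K" "K \<subseteq> {0..}"
      using \<open>finite T\<close> by (auto simp: K_def intro!: compact_UN)
    moreover have "{g \<in> real_funs. \<forall>t\<in>K. \<bar>f t - g t\<bar> < \<epsilon>} \<subseteq> U"
      unfolding K_def using uniform_nbhd_subset_elementary_nbhd sub by (rule subset_trans)
    ultimately show "\<exists>\<epsilon>>0. \<exists>K. compact K \<and> K \<subseteq> {0..} \<and>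
        {g \<in> real_funs. \<forall>t\<in>K. \<bar>f t - g t\<bar> < \<epsilon>} \<subseteq> U"
      using \<open>\<epsilon> > 0\<close> by blast
  qed
qed

theorem proposition1:
  shows "Hausdorff_space sticking_topology
    \<and> finer_topology sticking_topology pointwise_topology
    \<and> coarser_topology sticking_topology locally_uniform_topology"
  using Hausdorff_space_finer_topology[OF finer_sticking_pointwise Hausdorff_space_pointwise_topology]
    finer_sticking_pointwise finer_locally_uniform_sticking by blast

end
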